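(* Let $u$ and $v$ be extremal partial isometries in a $C^*$-algebra $A$ such that $d = \|u - v\| \le \sqrt{2}$. Then $$\|u^*u - v^*v\| \le d\,(1 - d^2/4)^{1/2}.$$
   Context: An extremal partial isometry of a $C^*$-algebra $A$ is an extreme point of the closed unit ball of $A$. Known facts: the unit ball of $A$ has extreme points if and only if $A$ is unital (Sakai); extreme points are necessarily partial isometries; and, for a partial isometry $u$ in $A$ with $\mathbf{1}$ the identity of $A$, $u$ is an extreme point if and only if $(\mathbf{1} - uu^* )A(\mathbf{1} - u^*u) = \{0\}$ (Kadison). *)

theory Defs
  imports "HOL-Analysis.Analysis"
begin

text \<open>
  Complex C*-algebras, not assumed to be unital. The superclasses provide an associative real
  algebra with a complete submultiplicative norm; the axiom \<open>scaleC_of_real\<close> makes the complex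
  scalar multiplication extend the real one.
\<close>

class cstar_algebra = real_normed_algebra + banach +
  fixes scaleC :: "complex \<Rightarrow> 'a \<Rightarrow> 'a" (infixr "*\<^sub>C" 75)
    and star :: "'a \<Rightarrow> 'a"
  assumes scaleC_add_right: "c *\<^sub>C (x + y) = c *\<^sub>C x + c *\<^sub>C y"
    and scaleC_add_left: "(b + c) *\<^sub>C x = b *\<^sub>C x + c *\<^sub>C x"
    and scaleC_scaleC: "b *\<^sub>C c *\<^sub>C x = (b * c) *\<^sub>C x"
    and scaleC_of_real: "complex_of_real r *\<^sub>C x = r *\<^sub>R x"
    and mult_scaleC_left: "(c *\<^sub>C x) * y = c *\<^sub>C (x * y)"
    and mult_scaleC_right: "x * (c *\<^sub>C y) = c *\<^sub>C (x * y)"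
    and norm_scaleC: "norm (c *\<^sub>C x) = cmod c * norm x"
    and star_add: "star (x + y) = star x + star y"
    and star_scaleC: "star (c *\<^sub>C x) = cnj c *\<^sub>C star x"
    and star_mult: "star (x * y) = star y * star x"
    and star_star: "star (star x) = x"
    and cstar_identity: "norm (star x * x) = (norm x)\<^sup>2"

text \<open>
  That such an element is a partial isometry (\<open>u * star u * u = u\<close>), and that the algebra is then
  unital, are theorems and not part of the definition.
\<close>

definition extremal_partial_isometry :: "'a::cstar_algebra \<Rightarrow> bool" where
  "extremal_partial_isometry u \<longleftrightarrow> u extreme_point_of (cball 0 1)"

end

theory Submission
  imports Defs "HOL-Computational_Algebra.Polynomial"
begin

text \<open>
  If \<open>x* y\<close> is self-adjoint then \<open>\<parallel>x\<parallel>\<^sup>2 \<le> \<parallel>x* x + y* y\<parallel>\<close>. Together with square roots of \<open>1 - k\<close>, \<open>\<parallel>k\<parallel> < 1\<close>, this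
  replaces spectral theory and positivity, also without a unit. It shows that an extreme point \<open>u\<close> of the
  unit ball is a partial isometry, and then \<open>(1 - u u*) A (1 - u* u) = 0\<close> because \<open>\<parallel>u \<plusminus> y\<parallel>\<^sup>2 = \<parallel>u* u + y* y\<parallel>\<close> is
  the norm of an orthogonal sum for \<open>y\<close> in that corner. Only the instances \<open>(1 - v v*) u (1 - v* v) = 0\<close> and
  \<open>(1 - u u*) v (1 - u* u) = 0\<close> are needed: they bound \<open>\<parallel>p (1 - q)\<parallel>\<close> and \<open>\<parallel>q (1 - p)\<parallel>\<close>, where \<open>p = u* u\<close> and
  \<open>q = v* v\<close>, and \<open>\<parallel>p - q\<parallel>\<close> is the larger of the two.
\<close>

section \<open>The involution\<close>

lemma scaleC_one: "1 *\<^sub>C x = (x :: 'a::cstar_algebra)"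
  using scaleC_of_real[of 1 x] by simp

lemma scaleC_minus_left: "(- c) *\<^sub>C x = - (c *\<^sub>C (x :: 'a::cstar_algebra))"
proof -
  have "(- c) *\<^sub>C x + c *\<^sub>C x = complex_of_real 0 *\<^sub>C x"
    using scaleC_add_left[of "- c" c x] by simp
  then show ?thesis by (simp only: scaleC_of_real) (simp add: eq_neg_iff_add_eq_0)
qed

lemma scaleC_diff_right: "c *\<^sub>C (x - y) = c *\<^sub>C x - c *\<^sub>C (y :: 'a::cstar_algebra)"
  using scaleC_add_right[of c "x - y" y] by (simp add: eq_diff_eq)

lemma star_scaleR: "star (r *\<^sub>R x) = r *\<^sub>R star (x :: 'a::cstar_algebra)"
  using star_scaleC[of "complex_of_real r" x] by (simp add: scaleC_of_real)

lemma star_zero [simp]: "star (0 :: 'a::cstar_algebra) = 0"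
  using star_scaleR[of 0 "0 :: 'a"] by simp

lemma star_minus: "star (- x) = - star (x :: 'a::cstar_algebra)"
  using star_scaleR[of "-1" x] by simp

lemma star_diff: "star (x - y) = star x - star (y :: 'a::cstar_algebra)"
  using star_add[of x "- y"] by (simp add: star_minus)

lemmas star_simps = star_add star_diff star_minus star_scaleR star_mult star_star

lemma norm_star [simp]: "norm (star x) = norm (x :: 'a::cstar_algebra)"
proof -
  have le: "norm y \<le> norm (star y)" for y :: 'a
  proof (cases "y = 0")
    case False
    have "norm y * norm y \<le> norm (star y) * norm y"
      using norm_mult_ineq[of "star y" y] by (simp add: cstar_identity power2_eq_square)
    with False show ?thesis by simp
  qed simp
  show ?thesis using le[of x] le[of "star x"] by (simp add: star_star)
qed

lemma star_mult_self_eq_0: "star x * x = 0 \<Longrightarrow> x = (0 :: 'a::cstar_algebra)"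
  using cstar_identity[of x] by simp

lemma norm_square_selfadjoint:
  "star x = x \<Longrightarrow> norm (x * x) = (norm (x :: 'a::cstar_algebra))\<^sup>2"
  using cstar_identity[of x] by simp

lemma bounded_linear_star: "bounded_linear (star :: 'a::cstar_algebra \<Rightarrow> 'a)"
  by (rule bounded_linear_intro[where K = 1]) (simp_all add: star_add star_scaleR)

section \<open>Norm inequalities\<close>

text \<open>Both \<open>x + i y\<close> and \<open>x - i y\<close> have squared norm \<open>\<parallel>x* x + y* y\<parallel>\<close>, and \<open>x\<close> is their mean.\<close>

lemma norm_le_sum_squares:
  fixes x y :: "'a::cstar_algebra"
  assumes "star x * y = star y * x"
  shows "(norm x)\<^sup>2 \<le> norm (star x * x + star y * y)"
proof -
  let ?N = "norm (star x * x + star y * y)"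
  have cs: "(norm (x + c *\<^sub>C y))\<^sup>2 = ?N" if c: "c * c = - 1" "cnj c = - c" for c
  proof -
    have "star (x + c *\<^sub>C y) * (x + c *\<^sub>C y) =
      star x * x + c *\<^sub>C (star x * y) + cnj c *\<^sub>C (star y * x) + (cnj c * c) *\<^sub>C (star y * y)"
      by (simp add: star_add star_scaleC mult_scaleC_left mult_scaleC_right scaleC_scaleC scaleC_add_right
          mult.commute[of c "cnj c"]
          distrib_left distrib_right)
    also have "\<dots> = star x * x + star y * y"
      using assms by (simp add: c scaleC_minus_left scaleC_one)
    finally show ?thesis using cstar_identity[of "x + c *\<^sub>C y"] by simp
  qed
  have "norm (x + \<i> *\<^sub>C y) = sqrt ?N" "norm (x + (- \<i>) *\<^sub>C y) = sqrt ?N"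
    using cs[of \<i>] cs[of "- \<i>"] by (auto intro: real_sqrt_unique[symmetric])
  moreover have "(x + \<i> *\<^sub>C y) + (x + (- \<i>) *\<^sub>C y) = 2 *\<^sub>R x"
    by (simp add: scaleC_minus_left scaleR_2)
  ultimately have "norm (2 *\<^sub>R x) \<le> sqrt ?N + sqrt ?N"
    using norm_triangle_ineq[of "x + \<i> *\<^sub>C y" "x + (- \<i>) *\<^sub>C y"] by simp
  then have "norm x \<le> sqrt ?N" by simp
  then show ?thesis using power_mono[of "norm x" "sqrt ?N" 2] by simp
qed

text \<open>In the unitization, \<open>1 - s\<close> is a square root of \<open>1 - k\<close>.\<close>

lemma exists_sqrt:
  fixes k h :: "'a::cstar_algebra"
  assumes "star k = k" "norm k < 1" "k * h = h * k"
  obtains s where "star s = s" "s * h = h * s" "s + s - s * s = k"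
proof -
  \<comment> \<open>A fixed point of \<open>f\<close> satisfies (1 - s)^2 = 1 - k. The closed set
    \<open>S\<close> adds self-adjointness and commutation with \<open>h\<close> to the ball, so
    Banach's theorem preserves both.\<close>
  define f where "f s = (1/2) *\<^sub>R (k + s * s)" for s
  define S where "S = cball 0 (norm k) \<inter> {s. star s = s} \<inter> {s. s * h = h * s}"
  have "closed {s :: 'a. star s = s}"
    by (intro closed_Collect_eq bounded_linear.continuous_on[OF bounded_linear_star] continuous_intros)
  moreover have "closed {s. s * h = h * s}"
    by (intro closed_Collect_eq continuous_intros)
  ultimately have comp: "complete S"
    unfolding S_def complete_eq_closed by (intro closed_Int closed_cball)
  have "0 \<in> S" by (simp add: S_def)
  then have ne: "S \<noteq> {}" by blast
  have maps: "f ` S \<subseteq> S"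
  proof (rule image_subsetI)
    fix s assume s: "s \<in> S"
    then have ns: "norm s \<le> norm k" by (simp add: S_def)
    have "norm (s * s) \<le> norm k * norm k"
      using norm_mult_ineq[of s s] mult_mono[OF ns ns] by simp
    also have "\<dots> \<le> norm k"
      using assms(2) by (simp add: mult_left_le)
    finally have "norm (f s) \<le> norm k"
      unfolding f_def using norm_triangle_ineq[of k "s * s"] by simp
    moreover have "s * s * h = h * (s * s)"
    proof -
      have "s * h = h * s" using s by (simp add: S_def)
      then show ?thesis by (metis mult.assoc)
    qed
    ultimately show "f s \<in> S"
      using s assms(1,3) by (simp add: S_def f_def star_simps distrib_left distrib_right)
  qed
  have lip: "dist (f x) (f y) \<le> norm k * dist x y" if "x \<in> S" "y \<in> S" for x y
  proof -
    from that
    have n: "norm x \<le> norm k" "norm y \<le> norm k" by (simp_all add: S_def)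
    have "f x - f y = (1/2) *\<^sub>R (x * (x - y) + (x - y) * y)"
      by (simp add: f_def algebra_simps)
    then have "norm (f x - f y) \<le> (1/2) * (norm (x * (x - y)) + norm ((x - y) * y))"
      using norm_triangle_ineq[of "x * (x - y)" "(x - y) * y"] by simp
    also have "\<dots> \<le> (1/2) * (norm k * norm (x - y) + norm k * norm (x - y))"
    proof -
      have "norm (x * (x - y)) \<le> norm k * norm (x - y)"
        by (rule order_trans[OF norm_mult_ineq]) (simp add: n mult_right_mono)
      moreover have "norm ((x - y) * y) \<le> norm k * norm (x - y)"
        by (rule order_trans[OF norm_mult_ineq]) (simp add: n mult_right_mono mult.commute[of _ "norm y"])
      ultimately show ?thesis by simp
    qed
    finally show ?thesis by (simp add: dist_norm)
  qed
  obtain s where s: "s \<in> S" "f s = s"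
    using Banach_fix[OF comp ne norm_ge_zero assms(2) maps lip] by blast
  have "2 *\<^sub>R f s = k + s * s" by (simp add: f_def)
  then have "s + s - s * s = k" by (simp add: s(2) scaleR_2)
  with s(1) show ?thesis by (intro that[of s]) (simp_all add: S_def)
qed

text \<open>Write 1 - a^2 = (1 - s)^2. As (1 - s)^2 + a^2 = 1, the sum-of-squares inequality makes 1
  - s contractive; it is then applied twice.\<close>

lemma norm_diff_square_le:
  fixes a x :: "'a::cstar_algebra"
  assumes a: "star a = a" and "norm a < 1"
  shows "norm (x - a * (a * x)) \<le> norm x"
proof -
  have "norm (a * a) < 1"
    using assms by (simp add: norm_square_selfadjoint power_less_one_iff)
  then obtain s where s: "star s = s" "s * a = a * s" "s + s - s * s = a * a"
    using exists_sqrt[of "a * a" a] a by (auto simp: star_simps mult.assoc)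
  have sq: "(y - s * y) - s * (y - s * y) = y - a * (a * y)" for y
  proof -
    have "(y - s * y) - s * (y - s * y) = y - (s + s - s * s) * y"
      by (simp add: algebra_simps)
    then show ?thesis by (simp add: s(3) mult.assoc)
  qed
  have sa: "s * (a * y) = a * (s * y)" for y
    by (simp add: s(2) flip: mult.assoc)
  have *: "norm (y - s * y) \<le> norm y" for y
  proof -
    have c: "star (y - s * y) * (a * y) = star (a * y) * (y - s * y)"
      by (simp add: star_simps s a ring_distribs mult.assoc sa)
    have "star (y - s * y) * (y - s * y) = star y * ((y - s * y) - s * (y - s * y))"
      by (simp add: star_simps s algebra_simps)
    then have "star (y - s * y) * (y - s * y) + star (a * y) * (a * y) = star y * y"
      by (simp add: sq) (simp add: star_simps a algebra_simps)
    with norm_le_sum_squares[OF c] have "(norm (y - s * y))\<^sup>2 \<le> (norm y)\<^sup>2"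
      by (simp add: cstar_identity)
    then show ?thesis by (simp add: power2_le_iff_abs_le)
  qed
  show ?thesis
    using *[of x] *[of "x - s * x"] by (simp add: sq)
qed

lemma norm_scaled_diff_square_le:
  fixes a x :: "'a::cstar_algebra"
  assumes a: "star a = a" and t: "t > norm a"
  shows "norm (t\<^sup>2 *\<^sub>R x - a * (a * x)) \<le> t\<^sup>2 * norm x"
proof -
  have "t > 0" using t norm_ge_zero[of a] by linarith
  then have "norm (x - (a /\<^sub>R t) * ((a /\<^sub>R t) * x)) \<le> norm x"
    using t by (intro norm_diff_square_le) (simp_all add: star_simps a field_simps)
  moreover have "t\<^sup>2 *\<^sub>R x - a * (a * x) = t\<^sup>2 *\<^sub>R (x - (a /\<^sub>R t) * ((a /\<^sub>R t) * x))"
    using \<open>t > 0\<close> by (simp add: scaleR_right_diff_distrib power2_eq_square mult.assoc[of t]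
        flip: mult.assoc[of t _ "inverse t"])
  ultimately show ?thesis
    by (simp only: norm_scaleR abs_power2) (simp add: mult_left_mono)
qed

text \<open>Squaring \<open>p + q\<close> gives the orthogonal sum of \<open>p * p\<close> and
  \<open>q * q\<close>. After n squarings the triangle inequality costs only a factor 2, whose
  2^n-th root tends to 1.\<close>

lemma norm_orthogonal_sum_le:
  fixes p q :: "'a::cstar_algebra"
  assumes "star p = p" "star q = q" "p * q = 0" "norm p \<le> r" "norm q \<le> r"
  shows "norm (p + q) \<le> r"
proof -
  have pow: "norm (p + q) ^ (2 ^ n) \<le> 2 * r ^ (2 ^ n)"
    if "star p = p" "star q = q" "p * q = 0" "norm p \<le> r" "norm q \<le> r"
    for n and p q :: 'a and r
    using that
  proof (induction n arbitrary: p q r)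
    case 0
    then show ?case using norm_triangle_ineq[of p q] by simp
  next
    case (Suc n)
    have qp: "q * p = 0"
      using arg_cong[OF Suc.prems(3), of star] by (simp only: star_mult Suc.prems(1,2) star_zero)
    have sq: "(p + q) * (p + q) = p * p + q * q"
      using Suc.prems(3) qp by (simp add: algebra_simps)
    have "norm (p + q) ^ (2 ^ Suc n) = ((norm (p + q))\<^sup>2) ^ (2 ^ n)"
      by (simp add: power_mult)
    also have "(norm (p + q))\<^sup>2 = norm (p * p + q * q)"
      using norm_square_selfadjoint[of "p + q"] Suc.prems by (simp add: star_add sq)
    also have "\<dots> ^ (2 ^ n) \<le> 2 * (r\<^sup>2) ^ (2 ^ n)"
    proof (rule Suc.IH)
      show "p * p * (q * q) = 0"
        using Suc.prems(3) by (metis mult.assoc mult_zero_left mult_zero_right)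
    qed (use Suc.prems in \<open>simp_all add: star_mult norm_square_selfadjoint power_mono\<close>)
    finally show ?case by (simp add: power_mult)
  qed
  have r: "r \<ge> 0" using assms(4) norm_ge_zero order_trans by blast
  show ?thesis
  proof (rule ccontr)
    assume "\<not> ?thesis"
    then have gt: "norm (p + q) > r" by simp
    show False
    proof (cases "r = 0")
      case True
      then show False using assms gt by simp
    next
      case False
      with r have "r > 0" by simp
      define c where "c = norm (p + q) / r"
      have "c > 1" using gt \<open>r > 0\<close> by (simp add: c_def)
      then obtain n where n: "2 < c ^ n" using real_arch_pow by blast
      have "c ^ n \<le> c ^ (2 ^ n)"
        using \<open>c > 1\<close> less_exp[of n] by (intro power_increasing) simp_all
      also have "\<dots> \<le> 2"
        using pow[OF assms, of n] \<open>r > 0\<close> by (simp add: c_def power_divide field_simps)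
      finally show False using n by simp
    qed
  qed
qed

section \<open>Extreme points of the unit ball\<close>

lemma extreme_point_perturb:
  fixes x y :: "'a::real_normed_vector"
  assumes "x extreme_point_of (cball 0 1)" "norm (x + y) \<le> 1" "norm (x - y) \<le> 1"
  shows "y = 0"
proof (rule ccontr)
  assume "y \<noteq> 0"
  moreover have "(x + y) - (x - y) = 2 *\<^sub>R y" by (simp add: scaleR_2)
  ultimately have "x + y \<noteq> x - y" by (metis cancel_comm_monoid_add_class.diff_cancel scaleR_eq_0_iff zero_neq_numeral)
  moreover have "x = (1 - 1/2) *\<^sub>R (x + y) + (1/2) *\<^sub>R (x - y)"
    by (simp add: algebra_simps flip: scaleR_left_distrib)
  ultimately have "x \<in> open_segment (x + y) (x - y)"
    unfolding in_segment by (intro conjI exI[of _ "1/2"]) simp_all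
  with assms show False by (auto simp: extreme_point_of_def)
qed

text \<open>\<open>poly_act h p y\<close> is \<open>p(h) y\<close>; acting on \<open>y\<close> makes sense of constant terms without a unit.\<close>

definition poly_act :: "'a::real_normed_algebra \<Rightarrow> real poly \<Rightarrow> 'a \<Rightarrow> 'a" where
  "poly_act h p y = fold_coeffs (\<lambda>a z. a *\<^sub>R y + h * z) p 0"

lemma poly_act_0 [simp]: "poly_act h 0 y = 0"
  by (simp add: poly_act_def)

lemma poly_act_pCons [simp]: "poly_act h (pCons a p) y = a *\<^sub>R y + h * poly_act h p y"
  by (cases "p = 0 \<and> a = 0") (auto simp: poly_act_def)

lemma poly_act_1 [simp]: "poly_act h 1 y = y"
  by (simp add: one_pCons)

lemma poly_act_smult: "poly_act h (smult c p) y = c *\<^sub>R poly_act h p y"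
  by (induction p) (simp_all add: scaleR_right_distrib)

lemma poly_act_add: "poly_act h (p + q) y = poly_act h p y + poly_act h q y"
  by (induction p q rule: poly_induct2) (simp_all add: algebra_simps)

lemma poly_act_diff: "poly_act h (p - q) y = poly_act h p y - poly_act h q y"
  using poly_act_add[of h "p - q" q y] by simp

lemma poly_act_mult: "poly_act h (p * q) y = poly_act h p (poly_act h q y)"
  by (induction p) (simp_all add: poly_act_add poly_act_smult)

lemma poly_act_diff_right: "poly_act h p (y - z) = poly_act h p y - poly_act h p z"
  by (induction p) (simp_all add: scaleR_right_diff_distrib right_diff_distrib)

lemma poly_act_mult_right: "poly_act h p y * z = poly_act h p (y * z)"
  by (induction p) (simp_all add: distrib_right mult.assoc)

lemma poly_act_commute: "s * h = h * s \<Longrightarrow> s * poly_act h p y = poly_act h p (s * y)"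
proof (induction p)
  case (pCons a p)
  then have "s * (h * poly_act h p y) = h * (s * poly_act h p y)" by (metis mult.assoc)
  with pCons show ?case by (simp add: distrib_left)
qed simp

text \<open>Real coefficients make p(h) self-adjoint; the factor \<open>z\<close> lets this be said
  when p(h) has a constant term.\<close>

lemma star_poly_act_mult:
  assumes "star h = (h :: 'a::cstar_algebra)"
  shows "star (poly_act h p y) * z = star y * poly_act h p z"
proof (induction p arbitrary: z)
  case (pCons a p)
  have "h * poly_act h p z = poly_act h p (h * z)" by (rule poly_act_commute) simp
  with pCons.IH[of "h * z"] show ?case
    by (simp add: star_simps assms distrib_left distrib_right mult.assoc)
qed simp

text \<open>
  With \<open>h = x* x\<close> the element has square \<open>H = h (5 - h\<^sup>2)\<^sup>2 / 16\<close>, and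
  \<open>1 - H\<^sup>2 = (1 - h\<^sup>2)\<^sup>2 (1 - k)\<close> with \<open>\<parallel>k\<parallel> < 1\<close>. So \<open>1 - H\<^sup>2\<close> is the square of a self-adjoint
  element commuting with \<open>H\<close>, which forces \<open>\<parallel>H\<parallel> \<le> 1\<close>. The scalar inequality behind it holds on all
  of \<open>[-1, 1]\<close>, so that positivity of \<open>h\<close> plays no role.
\<close>

lemma norm_quintic_le_1:
  fixes x :: "'a::cstar_algebra"
  defines "h \<equiv> star x * x"
  assumes x: "norm x \<le> 1"
  shows "norm ((5/4) *\<^sub>R x - (1/4) *\<^sub>R (x * (h * h))) \<le> 1"
proof -
  have h: "star h = h" by (simp add: h_def star_simps)
  have nh: "norm h \<le> 1" using x by (simp add: h_def cstar_identity power_le_one)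
  \<comment> \<open>On scalars 1 - Q^2 has double zeros at 1 and -1; dividing by N^2 leaves 1 - t
    P(t). The absolute coefficients of \<open>P\<close> sum to 132/256, whence
    \<open>norm k < 1\<close>.\<close>
  define K N P Q :: "real poly" where "K = [:5/4, 0, -1/4:]" and "N = [:1, 0, -1:]"
    and "P = [:0, 113/256, 0, -18/256, 0, 1/256:]" and "Q = K * [:0, 1:] * K"
  have poly_id: "N * N * (1 - [:0, 1:] * P) + Q * Q = 1"
    by (simp add: K_def N_def P_def Q_def one_pCons)
  define z where "z = (5/4) *\<^sub>R x - (1/4) *\<^sub>R (x * (h * h))"
  define H where "H = star z * z"
  have H: "star H = H" by (simp add: H_def star_simps)
  have H_act: "H * y = poly_act h Q y" for y
  proof -
    have "z * y = x * poly_act h K y"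
      by (simp add: z_def K_def algebra_simps)
    moreover have "star z * y = poly_act h K (star x * y)" for y
      by (simp add: z_def K_def star_simps h algebra_simps)
    moreover have "star x * (x * y) = h * y" for y
      by (simp add: h_def mult.assoc)
    moreover have "H * y = star z * (z * y)"
      by (simp only: H_def mult.assoc)
    ultimately have "H * y = poly_act h K (h * poly_act h K y)"
      by simp
    then show ?thesis unfolding Q_def poly_act_mult by simp
  qed
  define k where "k = poly_act h P h"
  have "star k = k" by (simp add: k_def P_def star_simps h distrib_left distrib_right
        left_diff_distrib right_diff_distrib mult.assoc)
  have kh: "k * h = h * k"
    unfolding k_def by (simp add: poly_act_mult_right poly_act_commute)
  have k_act: "y - k * y = poly_act h (1 - [:0, 1:] * P) y" for y
    by (simp add: k_def poly_act_mult_right poly_act_diff poly_act_commute[of h h])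
  have nmul: "norm (h * y) \<le> 1" if "norm y \<le> 1" for y
    by (rule order_trans[OF norm_mult_ineq]) (use nh that in \<open>simp add: mult_le_one\<close>)
  have "k = (113/256) *\<^sub>R (h * h) + (-18/256) *\<^sub>R (h * (h * (h * h)))
      + (1/256) *\<^sub>R (h * (h * (h * (h * (h * h)))))"
    by (simp add: k_def P_def distrib_left right_diff_distrib)
  then have "norm k \<le> norm ((113/256) *\<^sub>R (h * h)) + norm ((-18/256) *\<^sub>R (h * (h * (h * h))))
      + norm ((1/256) *\<^sub>R (h * (h * (h * (h * (h * h))))))"
    by (simp only:) (intro norm_triangle_le add_mono norm_triangle_ineq order_refl)
  also have "\<dots> \<le> 113/256 * 1 + 18/256 * 1 + 1/256 * 1"
    unfolding norm_scaleR by (intro add_mono mult_mono nmul nh) simp_all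
  finally have "norm k < 1" by simp
  then obtain s where s: "star s = s" "s * h = h * s" "s + s - s * s = k"
    using exists_sqrt[OF \<open>star k = k\<close> _ kh] by blast
  have sq: "(y - s * y) - s * (y - s * y) = y - k * y" for y
    unfolding s(3)[symmetric] by (simp add: algebra_simps)
  have s_act: "poly_act h p y - s * poly_act h p y = poly_act h p (y - s * y)" for p y
    by (simp add: poly_act_diff_right poly_act_commute s(2))
  have star_s: "star (y - s * y) * w = star y * (w - s * w)" for y w
    by (simp add: star_simps s(1) left_diff_distrib right_diff_distrib mult.assoc)
  \<comment> \<open>These are H^2 and (1 - h^2)(1 - s) H; by \<open>poly_id\<close> their squares
    add up to H^2.\<close>
  define X Y where "X = poly_act h Q H" and "Y = poly_act h N (H - s * H)"
  have "star X * Y = star Y * X"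
    by (simp add: X_def Y_def star_poly_act_mult[OF h] star_s s_act H mult.commute[of N Q] flip: poly_act_mult)
  moreover have "star X * X + star Y * Y = H * H"
  proof -
    have "star X * X + star Y * Y =
        H * (poly_act h (Q * Q) H + poly_act h (N * N) ((H - s * H) - s * (H - s * H)))"
      by (simp add: X_def Y_def star_poly_act_mult[OF h] star_s s_act H distrib_left flip: poly_act_mult)
    also have "\<dots> = H * poly_act h (N * N * (1 - [:0, 1:] * P) + Q * Q) H"
      unfolding sq k_act by (simp add: poly_act_add add.commute flip: poly_act_mult del: mult_pCons_left)
    finally show ?thesis by (simp only: poly_id poly_act_1)
  qed
  ultimately have "(norm X)\<^sup>2 \<le> norm (H * H)"
    using norm_le_sum_squares[of X Y] by simp
  moreover have "X = H * H" by (simp add: X_def H_act)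
  ultimately have "((norm H)\<^sup>2)\<^sup>2 \<le> (norm H)\<^sup>2"
    by (simp add: norm_square_selfadjoint H)
  then have "norm H \<le> 1"
    using power_strict_increasing[of 2 4 "norm H"] by (fastforce simp flip: power_mult)
  then have "(norm z)\<^sup>2 \<le> 1" by (simp add: H_def cstar_identity)
  then show ?thesis by (simp add: z_def power_le_one_iff)
qed

text \<open>The scalar function t (5 - t^4) / 4 has maximum 1 on [0, 1], attained at t = 1. Moving
  \<open>x\<close> by y = (x - x h^2) / 4 gives this quintic in one direction and a convex
  combination of \<open>x\<close> and x h^2 in the other; both stay in the ball.\<close>

lemma extreme_point_cubic:
  fixes x :: "'a::cstar_algebra"
  assumes x: "x extreme_point_of (cball 0 1)"
  shows "x * (star x * x) * (star x * x) = x"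
proof -
  define h where "h = star x * x"
  have nx: "norm x \<le> 1" using x by (simp add: extreme_point_of_def)
  define y where "y = (1/4) *\<^sub>R (x - x * (h * h))"
  have "x + y = (5/4) *\<^sub>R x - (1/4) *\<^sub>R (x * (h * h))"
    using scaleR_left_distrib[of 1 "1/4" x] by (simp add: y_def scaleR_right_diff_distrib)
  then have "norm (x + y) \<le> 1"
    using norm_quintic_le_1[OF nx] by (simp add: h_def)
  moreover have "norm (x - y) \<le> 1"
  proof -
    have "norm h \<le> 1" using nx by (simp add: h_def cstar_identity power_le_one)
    then have "norm (h * h) \<le> 1"
      using norm_mult_ineq[of h h] mult_le_one[of "norm h" "norm h"] by simp
    then have "norm (x * (h * h)) \<le> 1"
      using norm_mult_ineq[of x "h * h"] mult_le_one[of "norm x" "norm (h * h)"] nx by simp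
    moreover have "x - y = (3/4) *\<^sub>R x + (1/4) *\<^sub>R (x * (h * h))"
      using scaleR_left_diff_distrib[of 1 "1/4" x] by (simp add: y_def scaleR_right_diff_distrib)
    ultimately show ?thesis
      using norm_triangle_ineq[of "(3/4) *\<^sub>R x" "(1/4) *\<^sub>R (x * (h * h))"] nx by simp
  qed
  ultimately have "y = 0" by (rule extreme_point_perturb[OF x])
  then show ?thesis by (simp add: y_def h_def mult.assoc)
qed

text \<open>
  Here \<open>h = x* x\<close> satisfies \<open>h\<^sup>3 = h\<close>, and \<open>E = h\<^sup>2 - h\<close> is twice its negative spectral projection.
  For \<open>z = x - x h\<close> one has \<open>z* z = -2 E\<close>, and with \<open>G = - z z*\<close> and, up to sign, the real and imaginary parts
  \<open>a, b\<close> of \<open>2 z\<close>, \<open>4 E = - a\<^sup>2 - b\<^sup>2 - 2 G\<close>, where \<open>G = (G/2)\<^sup>2\<close>. So \<open>- 4 E\<close> is a sum of squares, and this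
  contradicts \<open>E\<^sup>2 = 2 E\<close> unless \<open>E = 0\<close>.
\<close>

lemma extreme_point_partial_isometry:
  fixes x :: "'a::cstar_algebra"
  assumes x: "x extreme_point_of (cball 0 1)"
  shows "x * (star x * x) = x"
proof -
  define h where "h = star x * x"
  have h: "star h = h" by (simp add: h_def star_simps)
  have xhh: "x * (h * h) = x"
    using extreme_point_cubic[OF x] by (simp add: h_def mult.assoc)
  have hhh: "h * (h * h) = h"
    using xhh by (simp add: h_def mult.assoc)
  have hhhw: "h * (h * (h * w)) = h * w" for w
    using hhh by (metis mult.assoc)
  define E z where "E = h * h - h" and "z = x - x * h"
  have EE: "E * E = 2 *\<^sub>R E"
    by (simp add: E_def algebra_simps hhh hhhw scaleR_2)
  have zz: "star z * z = (-2) *\<^sub>R E"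
  proof -
    have "star z * z = h - h * h - h * h + h * (h * h)"
      by (simp add: z_def star_simps h algebra_simps h_def)
    then show ?thesis by (simp add: hhh E_def algebra_simps flip: scaleR_2)
  qed
  have "z * h = - z" "z * (h * h) = z"
    using xhh hhh by (simp_all add: z_def left_diff_distrib mult.assoc)
  then have zE: "z * E = 2 *\<^sub>R z"
    by (simp add: E_def right_diff_distrib scaleR_2)
  define G where "G = - (z * star z)"
  have G: "star G = G" by (simp add: G_def star_simps)
  have GG: "G * G = 4 *\<^sub>R G"
  proof -
    have "G * G = z * (star z * z) * star z"
      by (simp add: G_def mult.assoc)
    then show ?thesis by (simp add: zz zE G_def)
  qed
  define a b c where "a = z + star z" and "b = \<i> *\<^sub>C (z - star z)" and "c = (1/2) *\<^sub>R G"
  have sa: "star a = a" and sc: "star c = c"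
    by (simp_all add: a_def c_def star_simps G)
  have sb: "star b = b"
    by (simp add: b_def star_scaleC star_diff star_star scaleC_minus_left scaleC_diff_right)
  have bb: "b * b = - ((z - star z) * (z - star z))"
    by (simp only: b_def mult_scaleC_left mult_scaleC_right scaleC_scaleC)
       (simp add: scaleC_minus_left scaleC_one)
  have "a * a + b * b = 2 *\<^sub>R (z * star z) + 2 *\<^sub>R (star z * z)"
    unfolding bb by (simp add: a_def algebra_simps scaleR_2)
  then have ab: "a * a + b * b = (-2) *\<^sub>R G + (-4) *\<^sub>R E"
    by (simp add: G_def zz)
  have cc: "c * c = G"
    by (simp add: c_def GG)
  \<comment> \<open>Each bound must strictly exceed its norm, hence the 1. As
    \<open>E * E = 2 *\<^sub>R E\<close>, (4 E) E = 8 E; spreading T over the squares then bounds (T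
    + 8) \<open>norm E\<close> by T \<open>norm E\<close>.\<close>
  define ta tb tc where "ta = norm a + 1" and "tb = norm b + 1" and "tc = norm c + 1"
  define T where "T = ta\<^sup>2 + tb\<^sup>2 + 2 * tc\<^sup>2"
  have "(T + 8) *\<^sub>R E = T *\<^sub>R E + (4 *\<^sub>R E) * E"
    by (simp add: EE scaleR_left_distrib)
  also have "4 *\<^sub>R E = - (a * a + b * b) - 2 *\<^sub>R (c * c)"
    by (simp add: ab cc)
  also have "T *\<^sub>R E + (- (a * a + b * b) - 2 *\<^sub>R (c * c)) * E =
      (ta\<^sup>2 *\<^sub>R E - a * (a * E)) + (tb\<^sup>2 *\<^sub>R E - b * (b * E)) + 2 *\<^sub>R (tc\<^sup>2 *\<^sub>R E - c * (c * E))"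
    by (simp add: T_def scaleR_left_distrib scaleR_right_diff_distrib left_diff_distrib
        distrib_right mult.assoc)
  finally have "(T + 8) * norm E \<le> norm ((ta\<^sup>2 *\<^sub>R E - a * (a * E)) + (tb\<^sup>2 *\<^sub>R E - b * (b * E))
      + 2 *\<^sub>R (tc\<^sup>2 *\<^sub>R E - c * (c * E)))"
    using norm_scaleR[of "T + 8" E] by (simp add: T_def)
  also have "\<dots> \<le> ta\<^sup>2 * norm E + tb\<^sup>2 * norm E + 2 * (tc\<^sup>2 * norm E)"
    by (intro norm_triangle_le add_mono norm_scaled_diff_square_le sa sb)
       (simp_all add: ta_def tb_def tc_def norm_scaled_diff_square_le sc)
  finally have "norm E \<le> 0" by (simp add: T_def algebra_simps)
  then have "z = 0" using star_mult_self_eq_0[of z] by (simp add: zz)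
  then show ?thesis by (simp add: z_def h_def)
qed

lemma star_partial_isometry:
  assumes "u * (star u * u) = (u :: 'a::cstar_algebra)"
  shows "star u * (u * star u) = star u"
proof -
  have "star (u * (star u * u)) = star u" by (simp only: assms)
  then show ?thesis by (simp add: star_mult star_star mult.assoc)
qed

lemma extreme_point_Kadison:
  fixes u a :: "'a::cstar_algebra"
  assumes u: "u extreme_point_of (cball 0 1)"
  shows "a - u * (star u * a) - a * (star u * u) + u * (star u * (a * (star u * u))) = 0"
proof -
  have pi: "u * (star u * u) = u"
    by (rule extreme_point_partial_isometry[OF u])
  then have piw: "u * (star u * (u * w)) = u * w" for w
    by (metis mult.assoc)
  have spiw: "star u * (u * (star u * w)) = star u * w" for w
    using star_partial_isometry[OF pi] by (metis mult.assoc)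
  have nu: "norm u \<le> 1" using u by (simp add: extreme_point_of_def)
  define y where "y = a - u * (star u * a) - a * (star u * u) + u * (star u * (a * (star u * u)))"
  define w where "w = (1 / (norm y + 1)) *\<^sub>R y"
  have "norm y < norm y + 1" by simp
  then have nw: "norm w \<le> 1"
    by (simp add: w_def field_simps add_pos_nonneg abs_of_pos)
  have "star u * y = 0"
    by (simp add: y_def distrib_left right_diff_distrib spiw)
  then have uw: "star u * w = 0" by (simp add: w_def)
  then have wu: "star w * u = 0"
    by (metis star_mult star_star star_zero)
  have "y * (star u * u) = 0"
    by (simp add: y_def distrib_right left_diff_distrib mult.assoc spiw)
  then have "w * (star u * u) = 0" by (simp add: w_def)
  from arg_cong[OF this, of star] have pw: "star u * (u * star w) = 0"
    by (simp add: star_simps mult.assoc)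
  have ball: "norm (u + c *\<^sub>R w) \<le> 1" if "c * c = 1" for c
  proof -
    have "norm (star u * u + star w * w) \<le> 1"
    proof (rule norm_orthogonal_sum_le)
      show "star u * u * (star w * w) = 0"
        using pw by (metis mult.assoc mult_zero_left)
    qed (use nu nw in \<open>simp_all add: star_simps cstar_identity power_le_one\<close>)
    moreover have "star (u + c *\<^sub>R w) * (u + c *\<^sub>R w) = star u * u + star w * w"
      by (simp add: star_simps distrib_left distrib_right uw wu that)
    ultimately have "(norm (u + c *\<^sub>R w))\<^sup>2 \<le> 1"
      using cstar_identity[of "u + c *\<^sub>R w"] by simp
    then show ?thesis by (simp add: power_le_one_iff)
  qed
  have "w = 0"
    using extreme_point_perturb[OF u] ball[of 1] ball[of "-1"] by simp
  moreover have "norm y + 1 \<noteq> 0" using norm_ge_zero[of y] by linarith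
  ultimately show ?thesis by (simp add: w_def y_def)
qed

section \<open>Distance of the initial projections\<close>

text \<open>
  Write \<open>p = u* u\<close>, \<open>q = v* v\<close> and \<open>b = u (1 - q)\<close>; the hypothesis on \<open>f = v v*\<close> says that \<open>f b = b\<close>. For
  \<open>c = 1 - d\<^sup>2/2\<close> and \<open>Y = (u - c v)* b\<close>, one has \<open>Y* Y = c w* w + (1 - c)\<^sup>2 b* b\<close> with \<open>w = (u - v)* b\<close>, so that
  \<open>\<parallel>Y\<parallel>\<^sup>2 \<le> (1 - c\<^sup>2) \<parallel>b\<parallel>\<^sup>2\<close>. On the other hand \<open>(1 - q) Y = b* b\<close>.
\<close>

lemma norm_initial_projection_diff_le:
  fixes u v :: "'a::cstar_algebra"
  assumes u: "u * (star u * u) = u" and v: "v * (star v * v) = v"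
    and K: "u - v * (star v * u) - u * (star v * v) + v * (star v * (u * (star v * v))) = 0"
    and d: "d = norm (u - v)" "d \<le> sqrt 2"
  shows "(norm (star u * u - star u * u * (star v * v)))\<^sup>2 \<le> d\<^sup>2 * (1 - d\<^sup>2 / 4)"
proof -
  define p q where "p = star u * u" and "q = star v * v"
  have p: "star p = p" "p * p = p" "u * p = u"
    using u by (simp_all add: p_def star_simps mult.assoc)
  have q: "star q = q" "q * q = q" "v * q = v" "q * star v = star v"
    using v star_partial_isometry[OF v] by (simp_all add: q_def star_simps mult.assoc)
  have pw: "p * (p * w) = p * w" and qw: "q * (q * w) = q * w" and qv: "q * (star v * w) = star v * w" for w
    using p(2) q(2,4) by (metis mult.assoc)+
  \<comment> \<open>This \<open>c\<close> minimises c d^2 + (1 - c)^2, with minimum 1 - c^2 = d^2 (1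
    - d^2/4). The bound on \<open>d\<close> gives \<open>c \<ge> 0\<close>, as estimating the
    \<open>w\<close> term requires.\<close>
  define c where "c = 1 - d\<^sup>2 / 2"
  have "d\<^sup>2 \<le> 2" using power_mono[OF d(2), of 2] d(1) by simp
  then have c: "c \<ge> 0" by (simp add: c_def)
  define b x t where "b = u - u * q" and "x = p - p * q" and "t = star v * b"
  have vb: "v * t = b"
    using K by (simp add: b_def t_def q_def[symmetric] right_diff_distrib mult.assoc algebra_simps)
  have "star u * b = x"
    by (simp add: b_def x_def p_def right_diff_distrib mult.assoc)
  have h: "star b * b = star x * x"
    by (simp add: b_def x_def star_simps p q left_diff_distrib right_diff_distrib mult.assoc pw)
       (simp add: p_def mult.assoc)
  then have nb: "norm b = norm x"
    using cstar_identity[of b] cstar_identity[of x] by (simp add: power2_eq_iff_nonneg)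
  have tt: "star t * t = star x * x"
  proof -
    have "star t * t = star b * (v * t)" by (simp add: t_def star_simps mult.assoc)
    then show ?thesis by (simp add: vb h)
  qed
  define Y w where "Y = x - c *\<^sub>R t" and "w = x - t"
  have "w = star (u - v) * b"
    using \<open>star u * b = x\<close> by (simp add: w_def t_def star_simps left_diff_distrib)
  then have nw: "norm w \<le> d * norm x"
    using norm_mult_ineq[of "star (u - v)" b] by (simp add: d nb)
  \<comment> \<open>Since q v* = v*, the factor 1 - q annihilates \<open>t\<close> and leaves (1 -
    q) p (1 - q).\<close>
  have "Y - q * Y = star x * x"
    by (simp add: Y_def x_def t_def star_simps p q left_diff_distrib right_diff_distrib mult.assoc pw qv)
  moreover have "norm (Y - q * Y) \<le> norm Y"
  proof -
    have "star (Y - q * Y) * (Y - q * Y) = star Y * (Y - q * Y)"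
      by (simp add: star_simps q left_diff_distrib right_diff_distrib mult.assoc qw)
    then have "(norm (Y - q * Y))\<^sup>2 \<le> norm Y * norm (Y - q * Y)"
      using norm_mult_ineq[of "star Y" "Y - q * Y"] cstar_identity[of "Y - q * Y"] by simp
    then show ?thesis
      by (cases "Y - q * Y = 0") (simp_all add: power2_eq_square)
  qed
  ultimately have "(norm x)\<^sup>2 \<le> norm Y"
    using cstar_identity[of x] by simp
  then have "((norm x)\<^sup>2)\<^sup>2 \<le> norm (star Y * Y)"
    using power_mono[of "(norm x)\<^sup>2" "norm Y" 2] by (simp add: cstar_identity)
  also have "star Y * Y = c *\<^sub>R (star w * w) + (1 - c)\<^sup>2 *\<^sub>R (star x * x)"
  proof -
    have "star Y * Y = star x * x - c *\<^sub>R (star x * t + star t * x) + (c * c) *\<^sub>R (star x * x)"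
      by (simp add: Y_def star_simps left_diff_distrib right_diff_distrib tt scaleR_right_distrib
          scaleR_right_diff_distrib)
    moreover have "star w * w = 2 *\<^sub>R (star x * x) - (star x * t + star t * x)"
      by (simp add: w_def star_simps left_diff_distrib right_diff_distrib tt scaleR_2)
    moreover have "(1 - c)\<^sup>2 = 1 - c - c + c * c"
      by (simp add: power2_eq_square algebra_simps)
    ultimately show ?thesis
      using scaleR_left_distrib[of c c "star x * x"]
      by (simp add: scaleR_left_distrib scaleR_left_diff_distrib scaleR_right_distrib
          scaleR_right_diff_distrib scaleR_2)
  qed
  also have "norm (c *\<^sub>R (star w * w) + (1 - c)\<^sup>2 *\<^sub>R (star x * x)) \<le> c * (norm w)\<^sup>2 + (1 - c)\<^sup>2 * (norm x)\<^sup>2"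
    using c by (intro norm_triangle_le) (simp add: cstar_identity)
  also have "\<dots> \<le> c * (d * norm x)\<^sup>2 + (1 - c)\<^sup>2 * (norm x)\<^sup>2"
    using c nw by (intro add_mono mult_left_mono power_mono) simp_all
  also have "\<dots> = d\<^sup>2 * (1 - d\<^sup>2 / 4) * (norm x)\<^sup>2"
    by (simp add: c_def power2_eq_square field_simps)
  finally have *: "(norm x)\<^sup>2 * (norm x)\<^sup>2 \<le> d\<^sup>2 * (1 - d\<^sup>2 / 4) * (norm x)\<^sup>2"
    by (simp add: power2_eq_square)
  show ?thesis
  proof (cases "x = 0")
    case True
    have "1 - d\<^sup>2 / 4 \<ge> 0" using \<open>d\<^sup>2 \<le> 2\<close> by simp
    with True show ?thesis by (simp add: x_def p_def q_def)
  next
    case False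
    with mult_right_le_imp_le[OF *] have "(norm x)\<^sup>2 \<le> d\<^sup>2 * (1 - d\<^sup>2 / 4)" by simp
    then show ?thesis by (simp add: x_def p_def q_def)
  qed
qed

text \<open>\<open>(p - q)\<^sup>2 = p (1 - q) p + (1 - p) q (1 - p)\<close> is an orthogonal sum.\<close>

lemma norm_projection_diff_le:
  fixes p q :: "'a::cstar_algebra"
  assumes p: "star p = p" "p * p = p" and q: "star q = q" "q * q = q"
    and "(norm (p - p * q))\<^sup>2 \<le> r" "(norm (q - q * p))\<^sup>2 \<le> r"
  shows "(norm (p - q))\<^sup>2 \<le> r"
proof -
  have pw: "p * (p * w) = p * w" and qw: "q * (q * w) = q * w" for w
    using p(2) q(2) by (metis mult.assoc)+
  define X Z where "X = p - p * (q * p)" and "Z = star (q - q * p) * (q - q * p)"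
  have "star (star (p - p * q)) * star (p - p * q) = X"
    by (simp add: X_def star_simps p q left_diff_distrib right_diff_distrib mult.assoc qw)
  then have nX: "norm X \<le> r"
    using cstar_identity[of "star (p - p * q)"] assms(5) by simp
  have nZ: "norm Z \<le> r"
    using assms(6) by (simp add: Z_def cstar_identity)
  have Z: "Z = q - q * p - p * q + p * (q * p)"
    by (simp add: Z_def star_simps p q left_diff_distrib right_diff_distrib mult.assoc qw)
  have "norm (X + Z) \<le> r"
  proof (rule norm_orthogonal_sum_le[OF _ _ _ nX nZ])
    show "X * Z = 0"
      by (simp add: X_def Z p q left_diff_distrib right_diff_distrib distrib_left mult.assoc pw qw)
  qed (simp_all add: X_def Z_def star_simps p q mult.assoc)
  moreover have "(p - q) * (p - q) = X + Z"
    by (simp add: X_def Z p q left_diff_distrib right_diff_distrib)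
  ultimately show ?thesis
    using norm_square_selfadjoint[of "p - q"] by (simp add: star_diff p q)
qed

theorem theorem7:
  fixes u v :: "'a::cstar_algebra" and d :: real
  assumes "extremal_partial_isometry u"
    and "extremal_partial_isometry v"
    and "d = norm (u - v)"
    and "d \<le> sqrt 2"
  shows "norm (star u * u - star v * v) \<le> d * sqrt (1 - d\<^sup>2 / 4)"
proof -
  have u: "u extreme_point_of (cball 0 1)" and v: "v extreme_point_of (cball 0 1)"
    using assms(1,2) by (simp_all add: extremal_partial_isometry_def)
  note pu = extreme_point_partial_isometry[OF u] and pv = extreme_point_partial_isometry[OF v]
  have "(norm (star u * u - star v * v))\<^sup>2 \<le> d\<^sup>2 * (1 - d\<^sup>2 / 4)"
  proof (rule norm_projection_diff_le)
    show "(norm (star u * u - star u * u * (star v * v)))\<^sup>2 \<le> d\<^sup>2 * (1 - d\<^sup>2 / 4)"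
      by (rule norm_initial_projection_diff_le[OF pu pv extreme_point_Kadison[OF v] assms(3,4)])
    show "(norm (star v * v - star v * v * (star u * u)))\<^sup>2 \<le> d\<^sup>2 * (1 - d\<^sup>2 / 4)"
      by (rule norm_initial_projection_diff_le[OF pv pu extreme_point_Kadison[OF u] _ assms(4)])
         (simp add: assms(3) norm_minus_commute)
  qed (simp_all add: star_simps pu pv mult.assoc)
  then have "norm (star u * u - star v * v) \<le> sqrt (d\<^sup>2 * (1 - d\<^sup>2 / 4))"
    by (rule real_le_rsqrt)
  then show ?thesis using assms(3) by (simp add: real_sqrt_mult)
qed

end
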